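(* Let $n\geq 2$ and $t>0$. The bent group $\Lambda_t=\rho_t(\pi_1(\mathcal{M}_0))\subset \mathrm{SL}_{n+1}(\mathbb{R})$, obtained by bending the hyperbolic manifold $\mathcal{M}_0$ along the totally geodesic hypersurface $\mathcal{N}_0$, is not a Schottky group.
   Context: An element $\gamma\in \mathrm{SL}_{n+1}(\mathbb{R})$ is loxodromic if the eigenvalues of $\gamma^2$ are simple and positive. A subgroup of $\mathrm{SL}_{n+1}(\mathbb{R})$ is a Schottky group if it is a discrete free group all of whose (nontrivial) elements are loxodromic. Let $q(x_1,\dots,x_{n+1})=x_1^2+\cdots+x_n^2-x_{n+1}^2$ and let $\Omega_0\subset\mathbb{P}^n$ be the projection of $\{q<0\}$ (the projective model of hyperbolic space $\mathbb{H}^n$, an ellipsoid); $\mathrm{SO}_{n,1}(\mathbb{R})=\mathrm{SO}(q)$. $\Lambda_0$ is a torsion-free finite-index subgroup of $\mathrm{SL}_{n+1}(\mathbb{Z})\cap \mathrm{SO}(q)$ such that, with $H=\Omega_0\cap\{x_1=0\}$ and $\Delta_0=\mathrm{Stab}_{\Lambda_0}(H)$, the quotient $\mathcal{N}_0=H/\Delta_0$ is a finite-volume two-sided hypersurface which embeds (properly, totally geodesically) in the non-compact finite-volume hyperbolic manifold $\mathcal{M}_0=\Omega_0/\Lambda_0$. Let $\rho_0:\pi_1(\mathcal{M}_0)\to\Lambda_0\subset \mathrm{SL}_{n+1}(\mathbb{R})$ be the holonomy. Bending. Put $a_t=\mathrm{diag}(e^{nt},e^{-t},\dots,e^{-t})$,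 which commutes with $\rho_0(\pi_1(\mathcal{N}_0))=\Delta_0$. If $\mathcal{M}_0\setminus\mathcal{N}_0$ has two components $\mathcal{M}_g,\mathcal{M}_d$, then $\pi_1(\mathcal{M}_0)=\pi_1(\mathcal{M}_g)*_{\pi_1(\mathcal{N}_0)}\pi_1(\mathcal{M}_d)$ and $\rho_t$ is the representation equal to $\rho_0$ on $\pi_1(\mathcal{M}_g)$ and to $a_t\rho_0(\cdot)a_t^{-1}$ on $\pi_1(\mathcal{M}_d)$. If $\mathcal{M}_0\setminus\mathcal{N}_0$ is connected, let $\mathcal{M}^\dagger$ be $\mathcal{M}_0$ cut along $\mathcal{N}_0$ (two boundary copies of $\mathcal{N}_0$); $\pi_1(\mathcal{M}_0)$ is an HNN extension of $\pi_1(\mathcal{M}^\dagger)$ with stable letter $\alpha$, where $\pi_1(\mathcal M^\dagger)$ is the stabilizer of a component $\mathcal{C}$ of $\Omega_0\setminus\bigcup_\gamma \gamma H$ and $\mathcal{C},\alpha\mathcal{C}$ are the two components bordering $H$; then $\rho_t=\rho_0$ on $\pi_1(\mathcal{M}^\dagger)$ and $\rho_t(\alpha)=a_t\rho_0(\alpha)$. In both cases $\Lambda_t=\rho_t(\pi_1(\mathcal{M}_0))$. *)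

theory Defs
  imports "HOL-Analysis.Analysis" "HOL-Algebra.Generated_Groups"
begin

section \<open>The special linear group and Schottky subgroups\<close>

text \<open>
  The index type \<open>'d\<close> has \<open>CARD('d) = n + 1\<close> elements; being finite and linearly ordered it is
  \<open>{1, \<dots>, n + 1}\<close> up to renaming, so \<open>ix_first\<close> and \<open>ix_last\<close> are the indices \<open>1\<close> and \<open>n + 1\<close>.
\<close>

definition ix_first :: "'d::{finite,linorder}" where "ix_first = Min UNIV"

definition ix_last :: "'d::{finite,linorder}" where "ix_last = Max UNIV"

definition SL :: "(real^'d^'d) monoid" where
  "SL = \<lparr>carrier = {A. det A = 1}, mult = (**), one = mat 1\<rparr>"

abbreviation SL_on :: "(real^'d^'d) set \<Rightarrow> (real^'d^'d) monoid" where
  "SL_on S \<equiv> SL\<lparr>carrier := S\<rparr>"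

lemma group_SL: "group (SL :: (real^'d::finite^'d) monoid)"
proof (rule groupI)
  fix A :: "real^'d^'d" assume "A \<in> carrier SL"
  then have d: "det A = 1" by (simp add: SL_def)
  then obtain B where B: "A ** B = mat 1" "B ** A = mat 1"
    by (metis invertible_def invertible_det_nz zero_neq_one)
  have "det B * det A = 1" using B(2) by (metis det_I det_mul)
  with d have "det B = 1" by simp
  with B show "\<exists>B\<in>carrier SL. B \<otimes>\<^bsub>SL\<^esub> A = \<one>\<^bsub>SL\<^esub>" by (auto simp: SL_def)
qed (auto simp: SL_def det_mul matrix_mul_assoc)

definition charpoly :: "'a::comm_ring_1^'d^'d \<Rightarrow> 'a poly" where
  "charpoly A = det (mat [:0, 1:] - map_matrix (\<lambda>a. [:a:]) A)"

text \<open>All complex eigenvalues of \<open>\<gamma>\<^sup>2\<close> are positive reals of algebraic multiplicity one.\<close>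

definition loxodromic :: "real^'d^'d \<Rightarrow> bool" where
  "loxodromic \<gamma> \<longleftrightarrow>
     (let p = charpoly (map_matrix complex_of_real (\<gamma> ** \<gamma>)) in
      \<forall>z. poly p z = 0 \<longrightarrow> Polynomial.order z p = 1 \<and> z \<in> \<real> \<and> Re z > 0)"

text \<open>Words in the letters \<open>s\<close> (flag \<open>True\<close>) and \<open>s\<inverse>\<close> (flag \<open>False\<close>).\<close>

definition word_value :: "('a, 'b) monoid_scheme \<Rightarrow> ('a \<times> bool) list \<Rightarrow> 'a" where
  "word_value G w = foldr (\<lambda>(s, b) x. (if b then s else inv\<^bsub>G\<^esub> s) \<otimes>\<^bsub>G\<^esub> x) w \<one>\<^bsub>G\<^esub>"

definition reduced_word :: "('a \<times> bool) list \<Rightarrow> bool" where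
  "reduced_word w \<longleftrightarrow> successively (\<lambda>x y. \<not> (fst x = fst y \<and> snd x \<noteq> snd y)) w"

definition free_group :: "('a, 'b) monoid_scheme \<Rightarrow> bool" where
  "free_group G \<longleftrightarrow> group G \<and>
     (\<exists>S \<subseteq> carrier G. generate G S = carrier G \<and>
        (\<forall>w. w \<noteq> [] \<and> fst ` set w \<subseteq> S \<and> reduced_word w \<longrightarrow> word_value G w \<noteq> \<one>\<^bsub>G\<^esub>))"

definition Schottky :: "(real^'d^'d) set \<Rightarrow> bool" where
  "Schottky \<Gamma> \<longleftrightarrow> subgroup \<Gamma> SL \<and> discrete \<Gamma> \<and> free_group (SL_on \<Gamma>) \<and>
     (\<forall>\<gamma>\<in>\<Gamma>. \<gamma> \<noteq> mat 1 \<longrightarrow> loxodromic \<gamma>)"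


section \<open>The arithmetic group\<close>

type_synonym 'd vect = "(real, 'd) vec"

type_synonym 'd sqmat = "((real, 'd) vec, 'd) vec"

definition q :: "'d::{finite,linorder} vect \<Rightarrow> real" where
  "q x = (\<Sum>i\<in>UNIV - {ix_last}. (x $ i)\<^sup>2) - (x $ ix_last)\<^sup>2"

definition SOq :: "'d::{finite,linorder} sqmat set" where
  "SOq = {A. det A = 1 \<and> (\<forall>x. q (A *v x) = q x)}"

definition SLZ :: "'d::finite sqmat set" where
  "SLZ = {A. det A = 1 \<and> (\<forall>i j. A $ i $ j \<in> \<int>)}"

definition torsion_free :: "('a, 'b) monoid_scheme \<Rightarrow> bool" where
  "torsion_free G \<longleftrightarrow>
     (\<forall>g\<in>carrier G. \<forall>k::nat. k > 0 \<and> g [^]\<^bsub>G\<^esub> k = \<one>\<^bsub>G\<^esub> \<longrightarrow> g = \<one>\<^bsub>G\<^esub>)"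


section \<open>Projective space and the projective model\<close>

definition quotient_topology :: "'a topology \<Rightarrow> ('a \<Rightarrow> 'b) \<Rightarrow> 'b topology" where
  "quotient_topology X f =
     topology (\<lambda>U. U \<subseteq> f ` topspace X \<and> openin X {x \<in> topspace X. f x \<in> U})"

lemma openin_quotient_topology:
  "openin (quotient_topology X f) U \<longleftrightarrow>
     U \<subseteq> f ` topspace X \<and> openin X {x \<in> topspace X. f x \<in> U}"
proof -
  have "istopology (\<lambda>U. U \<subseteq> f ` topspace X \<and> openin X {x \<in> topspace X. f x \<in> U})"
    unfolding istopology_def
  proof (intro conjI allI impI; (elim conjE)?)
    fix S T
    assume "openin X {x \<in> topspace X. f x \<in> S}" "openin X {x \<in> topspace X. f x \<in> T}"
    then have "openin X ({x \<in> topspace X. f x \<in> S} \<inter> {x \<in> topspace X. f x \<in> T})" by blast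
    then show "openin X {x \<in> topspace X. f x \<in> S \<inter> T}"
      by (rule back_subst[of "openin X"]) auto
  next
    fix K
    assume "\<forall>S\<in>K. S \<subseteq> f ` topspace X \<and> openin X {x \<in> topspace X. f x \<in> S}"
    then have "openin X (\<Union>S\<in>K. {x \<in> topspace X. f x \<in> S})" by blast
    then show "openin X {x \<in> topspace X. f x \<in> \<Union>K}"
      by (rule back_subst[of "openin X"]) auto
  qed auto
  then show ?thesis
    by (simp add: quotient_topology_def topology_inverse')
qed

lemma topspace_quotient_topology: "topspace (quotient_topology X f) = f ` topspace X"
proof
  have *: "{x \<in> topspace X. f x \<in> f ` topspace X} = topspace X" by auto
  have "openin (quotient_topology X f) (f ` topspace X)"
    by (simp add: openin_quotient_topology *)
  then show "f ` topspace X \<subseteq> topspace (quotient_topology X f)"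
    by (rule openin_subset)
qed (metis openin_quotient_topology openin_topspace)

lemma quotient_map_quotient_topology: "quotient_map X (quotient_topology X f) f"
  by (auto simp: quotient_map_def topspace_quotient_topology openin_quotient_topology)

text \<open>Points of \<open>\<P>\<^sup>n\<close> are the lines through the origin, as subsets of \<open>\<real>\<^sup>n\<^sup>+\<^sup>1\<close>.\<close>

definition line :: "'d::finite vect \<Rightarrow> 'd vect set" where "line v = span {v}"

definition proj_space :: "'d::finite vect set topology" where
  "proj_space = quotient_topology (top_of_set (- {0})) line"

definition pact :: "'d::finite sqmat \<Rightarrow> 'd vect set \<Rightarrow> 'd vect set" where
  "pact A L = (*v) A ` L"

definition Omega0 :: "'d::{finite,linorder} vect set set" where
  "Omega0 = line ` {v. q v < 0}"

definition Hyp :: "'d::{finite,linorder} vect set set" where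
  "Hyp = {L \<in> Omega0. \<forall>v\<in>L. v $ ix_first = 0}"

definition Stab :: "'d::finite sqmat set \<Rightarrow> 'd vect set set \<Rightarrow> 'd sqmat set" where
  "Stab \<Gamma> X = {g \<in> \<Gamma>. pact g ` X = X}"


section \<open>The manifold and the hypersurface\<close>

definition orbit_of :: "'d::finite sqmat set \<Rightarrow> 'd vect set \<Rightarrow> 'd vect set set" where
  "orbit_of \<Gamma> L = (\<lambda>g. pact g L) ` \<Gamma>"

definition M0 :: "'d::{finite,linorder} sqmat set \<Rightarrow> 'd vect set set topology" where
  "M0 \<Lambda> = quotient_topology (subtopology proj_space Omega0) (orbit_of \<Lambda>)"

definition N0 :: "'d::{finite,linorder} sqmat set \<Rightarrow> 'd vect set set topology" where
  "N0 \<Lambda> = quotient_topology (subtopology proj_space Hyp) (orbit_of (Stab \<Lambda> Hyp))"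

text \<open>The map \<open>N0 \<Lambda> \<rightarrow> M0 \<Lambda>\<close> induced by the inclusion of \<open>Hyp\<close> in \<open>Omega0\<close>: the orbit of \<open>L\<close> under
  the stabilizer of \<open>Hyp\<close> goes to the \<open>\<Lambda>\<close>-orbit of \<open>L\<close>.\<close>

definition N0_incl :: "'d::finite sqmat set \<Rightarrow> 'd vect set set \<Rightarrow> 'd vect set set" where
  "N0_incl \<Lambda> c = (\<Union>L\<in>c. orbit_of \<Lambda> L)"

definition two_sided :: "'a topology \<Rightarrow> 'b topology \<Rightarrow> ('a \<Rightarrow> 'b) \<Rightarrow> bool" where
  "two_sided N M \<iota> \<longleftrightarrow>
     (\<exists>h. embedding_map (prod_topology N (top_of_set {-1<..<1::real})) M h \<and>
          openin M (h ` (topspace N \<times> {-1<..<1})) \<and>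
          (\<forall>x\<in>topspace N. h (x, 0) = \<iota> x))"

text \<open>
  Hyperbolic volume on \<open>Omega0\<close> is, up to a constant factor depending on \<open>n\<close> only, the Lebesgue
  measure of the truncated cone \<open>{v. -1 < q v < 0, line v \<in> U}\<close>: in polar coordinates \<open>v = r u\<close>
  with \<open>q u = -1\<close> one has \<open>dv = r\<^sup>n dr dvol(u)\<close>.  The volume on \<open>Hyp\<close> is obtained in the same
  way inside the hyperplane \<open>x\<^sub>1 = 0\<close>, whose \<open>n\<close>-dimensional Lebesgue measure is the
  \<open>(n+1)\<close>-dimensional one of the slab of thickness \<open>1\<close> above it.
\<close>

definition cone_Omega :: "'d::{finite,linorder} vect set set \<Rightarrow> 'd vect set" where
  "cone_Omega U = {v. -1 < q v \<and> q v < 0 \<and> line v \<in> U}"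

definition cone_Hyp :: "'d::{finite,linorder} vect set set \<Rightarrow> 'd vect set" where
  "cone_Hyp U = {v. 0 < v $ ix_first \<and> v $ ix_first < 1 \<and>
                    v - axis ix_first (v $ ix_first) \<in> cone_Omega U}"

text \<open>\<open>D\<close> is a Borel set of representatives for the orbits, so that the volume of \<open>X/\<Gamma>\<close> is that
  of \<open>D\<close>.\<close>

definition finite_volume_quotient ::
  "('d::finite vect set set \<Rightarrow> 'd vect set) \<Rightarrow> 'd sqmat set \<Rightarrow> 'd vect set set \<Rightarrow> bool" where
  "finite_volume_quotient K \<Gamma> X \<longleftrightarrow>
     (\<exists>D \<subseteq> X. (\<forall>L\<in>X. \<exists>!L'. L' \<in> D \<and> L' \<in> orbit_of \<Gamma> L) \<and>
        K D \<in> sets borel \<and> emeasure lborel (K D) < \<infinity>)"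

definition M0_minus_N0 :: "'d::{finite,linorder} sqmat set \<Rightarrow> 'd vect set set topology" where
  "M0_minus_N0 \<Lambda> = subtopology (M0 \<Lambda>) (topspace (M0 \<Lambda>) - N0_incl \<Lambda> ` topspace (N0 \<Lambda>))"

definition admissible :: "'d::{finite,linorder} sqmat set \<Rightarrow> bool" where
  "admissible \<Lambda> \<longleftrightarrow>
     subgroup \<Lambda> (SL_on (SLZ \<inter> SOq)) \<and>
     finite (rcosets\<^bsub>SL_on (SLZ \<inter> SOq)\<^esub> \<Lambda>) \<and>
     torsion_free (SL_on \<Lambda>) \<and>
     \<not> compact_space (M0 \<Lambda>) \<and>
     finite_volume_quotient cone_Omega \<Lambda> Omega0 \<and>
     finite_volume_quotient cone_Hyp (Stab \<Lambda> Hyp) Hyp \<and>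
     embedding_map (N0 \<Lambda>) (M0 \<Lambda>) (N0_incl \<Lambda>) \<and>
     proper_map (N0 \<Lambda>) (M0 \<Lambda>) (N0_incl \<Lambda>) \<and>
     two_sided (N0 \<Lambda>) (M0 \<Lambda>) (N0_incl \<Lambda>)"


section \<open>Bending\<close>

definition bend :: "real \<Rightarrow> 'd::{finite,linorder} sqmat" where
  "bend t = (\<chi> i j. if i \<noteq> j then 0
                    else if i = ix_first then exp ((real CARD('d) - 1) * t) else exp (- t))"

definition chambers :: "'d::{finite,linorder} sqmat set \<Rightarrow> 'd vect set set set" where
  "chambers \<Lambda> = connected_components_of
     (subtopology proj_space (Omega0 - (\<Union>\<gamma>\<in>\<Lambda>. pact \<gamma> ` Hyp)))"

definition bordering :: "'d::{finite,linorder} sqmat set \<Rightarrow> 'd vect set set set" where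
  "bordering \<Lambda> = {C \<in> chambers \<Lambda>. Hyp \<subseteq> proj_space closure_of C}"

text \<open>
  The holonomy identifies \<open>\<pi>\<^sub>1(M0 \<Lambda>)\<close> with \<open>\<Lambda>\<close>.  In the separating case \<open>\<pi>\<^sub>1(M\<^sub>g)\<close> and
  \<open>\<pi>\<^sub>1(M\<^sub>d)\<close> are then the stabilizers of the two chambers \<open>Cg\<close>, \<open>Cd\<close> bordering \<open>Hyp\<close>, which lie
  over \<open>M\<^sub>g\<close> and \<open>M\<^sub>d\<close>; these stabilizers generate \<open>\<Lambda>\<close>, so the conditions determine \<open>\<rho>\<close>.
\<close>

definition separating_bending ::
  "'d::{finite,linorder} sqmat set \<Rightarrow> real \<Rightarrow> ('d sqmat \<Rightarrow> 'd sqmat) \<Rightarrow> bool" where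
  "separating_bending \<Lambda> t \<rho> \<longleftrightarrow>
     \<rho> \<in> hom (SL_on \<Lambda>) SL \<and>
     (\<exists>Cg Cd. bordering \<Lambda> = {Cg, Cd} \<and>
        connected_components_of (M0_minus_N0 \<Lambda>) = {orbit_of \<Lambda> ` Cg, orbit_of \<Lambda> ` Cd} \<and>
        orbit_of \<Lambda> ` Cg \<noteq> orbit_of \<Lambda> ` Cd \<and>
        (\<forall>\<gamma>\<in>Stab \<Lambda> Cg. \<rho> \<gamma> = \<gamma>) \<and>
        (\<forall>\<gamma>\<in>Stab \<Lambda> Cd. \<rho> \<gamma> = bend t ** \<gamma> ** matrix_inv (bend t)))"

definition nonseparating_bending ::
  "'d::{finite,linorder} sqmat set \<Rightarrow> real \<Rightarrow> ('d sqmat \<Rightarrow> 'd sqmat) \<Rightarrow> bool" where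
  "nonseparating_bending \<Lambda> t \<rho> \<longleftrightarrow>
     \<rho> \<in> hom (SL_on \<Lambda>) SL \<and>
     connected_space (M0_minus_N0 \<Lambda>) \<and>
     (\<exists>C. \<exists>\<alpha>\<in>\<Lambda>. bordering \<Lambda> = {C, pact \<alpha> ` C} \<and> pact \<alpha> ` C \<noteq> C \<and>
        (\<forall>\<gamma>\<in>Stab \<Lambda> C. \<rho> \<gamma> = \<gamma>) \<and>
        \<rho> \<alpha> = bend t ** \<alpha>)"

definition bending ::
  "'d::{finite,linorder} sqmat set \<Rightarrow> real \<Rightarrow> ('d sqmat \<Rightarrow> 'd sqmat) \<Rightarrow> bool" where
  "bending \<Lambda> t \<rho> \<longleftrightarrow> separating_bending \<Lambda> t \<rho> \<or> nonseparating_bending \<Lambda> t \<rho>"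

end

(* The standard form q is isotropic over the rationals, so an Eichler transvection gives explicit
   integral unipotent isometries of q; no appeal to the cusps of the quotient is needed.  For n >= 3
   the transvection can be chosen to preserve the hyperplane x_1 = 0.  A power of it lies in the
   finite-index subgroup and permutes the at most two chambers bordering the hyperplane, so its
   square T stabilizes both and is fixed by the bending: the bent group contains a nontrivial
   unipotent element, which is not loxodromic.  For n = 2 the hypotheses are contradictory: the
   geodesic x_1 = 0 joins two rational cusps, its stabilizer is finite, hence trivial, and it has
   infinite length. *)

theory Submission
  imports Defs
begin

section \<open>Non-loxodromic matrices\<close>

text \<open>Row operations preserve the determinant, and the common factor \<open>d\<close> then
  leaves by multilinearity.\<close>

lemma det_row_factor:
  fixes A :: "'a::comm_ring_1^'d^'d"
  assumes "i \<noteq> j" and "\<And>m. A $ i $ m + c * A $ j $ m = d * r $ m"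
  shows "det A = d * det (\<chi> m. if m = i then r else row m A)"
proof -
  have r: "row i A + c *s row j A = d *s r"
    using assms(2) by (simp add: vec_eq_iff row_def)
  have "det A = det (\<chi> m. if m = i then d *s r else row m A)"
    using det_row_operation[OF assms(1), of A c] by (simp only: r)
  then show ?thesis
    by (simp only: det_row_mul)
qed

text \<open>The hypotheses say that the linear form \<open>x\<^sub>j - x\<^sub>l\<close> is fixed by \<open>G\<close>, and that \<open>x\<^sub>k\<close> is fixed
  modulo this form: both rows of \<open>X - G\<close> become divisible by \<open>X - 1\<close> after a row operation.\<close>

lemma square_dvd_charpoly:
  fixes G :: "'a::comm_ring_1^'d^'d"
  assumes jkl: "j \<noteq> l" "k \<noteq> j"
    and j: "\<And>m. G $ j $ m - G $ l $ m = (if m = j then 1 else 0) - (if m = l then 1 else 0)"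
    and k: "\<And>m. G $ k $ m =
          (if m = k then 1 else 0) + s * ((if m = j then 1 else 0) - (if m = l then 1 else 0))"
  shows "[:-1, 1:]\<^sup>2 dvd charpoly G"
proof -
  define M where "M = mat [:0, 1:] - map_matrix (\<lambda>a. [:a:]) G"
  define u :: "'a poly^'d" where "u = (\<chi> m. (if m = j then 1 else 0) - (if m = l then 1 else 0))"
  define v :: "'a poly^'d" where "v = (\<chi> m. if m = k then 1 else 0)"
  define M' where "M' = (\<chi> m. if m = j then u else row m M)"
  have M: "M $ i $ m = (if i = m then [:0, 1:] else 0) - [:G $ i $ m:]" for i m
    by (simp add: M_def mat_def)
  have "M $ j $ m + (-1) * M $ l $ m = [:-1, 1:] * u $ m" for m
  proof -
    have "[:G $ j $ m:] - [:G $ l $ m:] = u $ m"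
      using j[of m] by (auto simp: u_def one_pCons)
    then have *: "[:G $ j $ m:] = u $ m + [:G $ l $ m:]"
      by (metis diff_add_cancel)
    have "M $ j $ m + (-1) * M $ l $ m =
        (if j = m then [:0, 1:] else 0) - (if l = m then [:0, 1:] else 0) - u $ m"
      by (simp add: M *)
    also have "\<dots> = [:-1, 1:] * u $ m"
      using jkl by (auto simp: u_def one_pCons)
    finally show ?thesis .
  qed
  then have 1: "det M = [:-1, 1:] * det M'"
    using det_row_factor[OF jkl(1), of M "-1" "[:-1, 1:]" u] by (simp add: M'_def)
  \<comment> \<open>Row \<open>j\<close> of \<open>M'\<close> is already \<open>u\<close>, so adding
    \<open>s\<close> times it cancels the off-diagonal part of row \<open>k\<close>.\<close>
  have "M' $ k $ m + [:s:] * M' $ j $ m = [:-1, 1:] * v $ m" for m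
    using jkl by (auto simp: M'_def row_def M k u_def v_def one_pCons)
  then have "det M' = [:-1, 1:] * det (\<chi> m. if m = k then v else row m M')"
    by (rule det_row_factor[OF jkl(2)])
  with 1 show ?thesis
    unfolding charpoly_def M_def[symmetric] power2_eq_square by (simp only: mult.assoc[symmetric] dvd_triv_left)
qed

lemma not_loxodromic_if_square_dvd:
  assumes "[:-1, 1:]\<^sup>2 dvd charpoly (map_matrix complex_of_real (A ** A))"
  shows "\<not> loxodromic A"
proof
  define p where "p = charpoly (map_matrix complex_of_real (A ** A))"
  assume "loxodromic A"
  then have roots: "Polynomial.order z p = 1 \<and> z \<in> \<real>" if "poly p z = 0" for z
    using that by (auto simp: loxodromic_def p_def Let_def)
  \<comment> \<open>The zero polynomial would have the non-real root \<open>\<i>\<close>;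
    \<open>order_divides\<close> then needs \<open>p \<noteq> 0\<close>.\<close>
  from roots[of \<i>] have "p \<noteq> 0"
    by (auto simp: complex_is_Real_iff)
  moreover have dvd: "[:-1, 1:]\<^sup>2 dvd p"
    using assms by (simp add: p_def)
  ultimately have "2 \<le> Polynomial.order 1 p"
    by (simp add: order_divides)
  moreover have "[:-1, 1:] dvd p"
    using dvd by (meson dvd_power dvd_trans pos2)
  then have "poly p 1 = 0"
    by (simp add: poly_eq_0_iff_dvd)
  ultimately show False
    using roots[of 1] by simp
qed


section \<open>Integral unipotent isometries\<close>

text \<open>The Eichler transvection \<open>x \<mapsto> x + s b(x,e) w - s b(x,w) e - s\<^sup>2/2 b(x,e) e\<close> of \<open>q\<close> for the
  isotropic vector \<open>e = e\<^sub>j + e\<^sub>l\<close> and the unit vector \<open>w = e\<^sub>k\<close> orthogonal to it.\<close>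

definition transv_fun :: "'d \<Rightarrow> 'd \<Rightarrow> 'd \<Rightarrow> real \<Rightarrow> real^'d \<Rightarrow> real^'d" where
  "transv_fun j k l s x = (\<chi> i. x $ i + (if i = k then s * (x $ j - x $ l) else 0)
     - (if i = j \<or> i = l then s * x $ k + s\<^sup>2 / 2 * (x $ j - x $ l) else 0))"

definition transv :: "'d::finite \<Rightarrow> 'd \<Rightarrow> 'd \<Rightarrow> real \<Rightarrow> real^'d^'d" where
  "transv j k l s = matrix (transv_fun j k l s)"

lemma linear_transv_fun: "linear (transv_fun j k l s)"
  by (rule linearI) (auto simp: transv_fun_def vec_eq_iff field_simps)

lemma transv_mult_vec: "transv j k l s *v x = transv_fun j k l s x"
  unfolding transv_def by (rule matrix_works) (use linear_transv_fun in \<open>simp add: linear_matrix_vector_mul_eq\<close>)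

lemma transv_entry:
  "transv j k l s $ i $ m = (if i = m then 1 else 0)
     + (if i = k then s * ((if m = j then 1 else 0) - (if m = l then 1 else 0)) else 0)
     - (if i = j \<or> i = l then s * (if m = k then 1 else 0)
          + s\<^sup>2 / 2 * ((if m = j then 1 else 0) - (if m = l then 1 else 0)) else 0)"
  unfolding transv_def by (auto simp: matrix_def transv_fun_def axis_def)

lemma transv_0: "transv j k l 0 = mat 1"
  by (auto simp: vec_eq_iff transv_entry mat_def)

lemma matrix_eqI: "(\<And>x. A *v x = B *v x) \<Longrightarrow> A = (B :: real^'d::finite^'d)"
  by (simp add: matrix_eq)

text \<open>The difference \<open>x $ j - x $ l\<close> is invariant and \<open>x $ k\<close> moves
  by \<open>s\<close> times it, so the parameters add.\<close>

lemma transv_mult: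
  assumes "j \<noteq> k" "j \<noteq> l" "k \<noteq> l"
  shows "transv j k l r ** transv j k l s = transv j k l (r + s)"
proof (rule matrix_eqI)
  fix x :: "real^'a"
  show "(transv j k l r ** transv j k l s) *v x = transv j k l (r + s) *v x"
    using assms
    by (auto simp: matrix_vector_mul_assoc[symmetric] transv_mult_vec transv_fun_def vec_eq_iff
        field_simps power2_eq_square)
qed

lemma det_involution:
  fixes A :: "real^'d::finite^'d"
  assumes "A ** A = mat 1"
  shows "(det A)\<^sup>2 = 1"
  by (metis assms det_I det_mul power2_eq_square)

text \<open>Conjugation by the reflection in \<open>e\<^sub>k\<close> inverts the transvection, so that its determinant
  is \<open>\<plusminus>1\<close>; moreover the transvection is a square.\<close>

lemma det_transv:
  assumes "j \<noteq> k" "j \<noteq> l" "k \<noteq> l"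
  shows "det (transv j k l s) = 1"
proof -
  define f :: "real^'a \<Rightarrow> real^'a" where "f x = (\<chi> i. if i = k then - x $ k else x $ i)" for x
  have "linear f"
    by (rule linearI) (auto simp: f_def vec_eq_iff)
  then have f: "matrix f *v x = f x" for x
    by (simp add: matrix_works)
  have "matrix f ** matrix f = mat 1"
    by (rule matrix_eqI) (auto simp: matrix_vector_mul_assoc[symmetric] f f_def vec_eq_iff)
  moreover have "(transv j k l s ** matrix f) ** (transv j k l s ** matrix f) = mat 1"
    using assms
    by (intro matrix_eqI) (auto simp: matrix_vector_mul_assoc[symmetric] f f_def transv_mult_vec
        transv_fun_def vec_eq_iff field_simps power2_eq_square)
  ultimately have "(det (transv j k l s))\<^sup>2 = 1"
    by (metis det_involution det_mul mult.right_neutral power_mult_distrib)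
  moreover have "det (transv j k l s) = (det (transv j k l (s / 2)))\<^sup>2"
    using transv_mult[OF assms, of "s / 2" "s / 2"] by (simp add: power2_eq_square flip: det_mul)
  ultimately show ?thesis
    by (metis power2_eq_1_iff zero_le_power2 not_one_le_zero neg_0_le_iff_le)
qed

section \<open>Transvections as integral isometries of \<open>q\<close>\<close>

lemma q_split:
  fixes x :: "'d::{finite,linorder} vect"
  assumes "j \<noteq> k" "j \<noteq> ix_last" "k \<noteq> ix_last"
  shows "q x = (\<Sum>i\<in>UNIV - {ix_last, j, k}. (x $ i)\<^sup>2) + (x $ j)\<^sup>2 + (x $ k)\<^sup>2 - (x $ ix_last)\<^sup>2"
proof -
  have "UNIV - {ix_last} = insert j (insert k (UNIV - {ix_last, j, k}))"
    using assms by auto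
  then show ?thesis
    using assms by (simp add: q_def)
qed

text \<open>With d = x_j - x_l, the square of x_k gains 2 s d x_k + s^2 d^2, which x_j^2 - x_l^2 = d
  (x_j + x_l) loses.\<close>

lemma q_transv:
  fixes x :: "'d::{finite,linorder} vect"
  assumes "j \<noteq> k" "j \<noteq> ix_last" "k \<noteq> ix_last"
  shows "q (transv j k ix_last s *v x) = q x"
proof -
  have "(\<Sum>i\<in>UNIV - {ix_last, j, k}. (transv_fun j k ix_last s x $ i)\<^sup>2) =
        (\<Sum>i\<in>UNIV - {ix_last, j, k}. (x $ i)\<^sup>2)"
    by (rule sum.cong) (auto simp: transv_fun_def)
  then show ?thesis
    using assms unfolding q_split[OF assms] transv_mult_vec
    by (simp add: transv_fun_def algebra_simps power2_eq_square)
qed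

text \<open>An even parameter makes the entry term \<open>s\<^sup>2 / 2\<close> integral.\<close>

lemma transv_in_SLZ:
  assumes "j \<noteq> k" "j \<noteq> l" "k \<noteq> l"
  shows "transv j k l (2 * of_int a) \<in> SLZ"
proof -
  have "(2 * real_of_int a)\<^sup>2 / 2 = of_int (2 * a\<^sup>2)"
    by (simp add: power2_eq_square)
  then have "(2 * real_of_int a)\<^sup>2 / 2 \<in> \<int>"
    by (metis Ints_of_int)
  then show ?thesis
    unfolding SLZ_def using det_transv[OF assms] by (auto simp: transv_entry)
qed

lemma transv_not_loxodromic:
  assumes "j \<noteq> k" "j \<noteq> l" "k \<noteq> l"
  shows "\<not> loxodromic (transv j k l s)"
proof (rule not_loxodromic_if_square_dvd)
  show "[:-1, 1:]\<^sup>2 dvd charpoly (map_matrix complex_of_real (transv j k l s ** transv j k l s))"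
    unfolding transv_mult[OF assms]
    \<comment> \<open>Loxodromy concerns the square, which is the transvection of parameter
      \<open>s + s\<close>.\<close>
    by (rule square_dvd_charpoly[where j = j and k = k and l = l and s = "of_real (s + s)"])
      (use assms in \<open>auto simp: transv_entry\<close>)
qed


section \<open>The action on projective space\<close>

lemma pact_pact: "pact A (pact B L) = pact (A ** B) L"
  by (simp add: pact_def image_image matrix_vector_mul_assoc)

lemma pact_mat_1 [simp]: "pact (mat 1) L = L"
  by (simp add: pact_def)

lemma pact_line: "pact A (line v) = line (A *v v)"
  unfolding pact_def line_def
  using linear_span_image[OF matrix_vector_mul_linear, of A "{v}"] by simp

text \<open>The left inverse keeps nonzero vectors nonzero, so the linear map descends through the
  quotient map \<open>line\<close>.\<close>

lemma continuous_map_pact: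
  assumes "B ** A = mat 1"
  shows "continuous_map proj_space proj_space (pact A)"
proof -
  have nz: "A *v v \<noteq> 0" if "v \<noteq> 0" for v
    using that matrix_vector_mul_assoc[of B A v] by (auto simp: assms)
  have q: "quotient_map (top_of_set (- {0})) proj_space line"
    unfolding proj_space_def by (rule quotient_map_quotient_topology)
  have "continuous_map (top_of_set (- {0})) (top_of_set (- {0})) ((*v) A)"
    using nz by (auto intro!: continuous_intros linear_continuous_on
        simp: linear_linear[symmetric])
  then have "continuous_map (top_of_set (- {0})) proj_space (line \<circ> (*v) A)"
    using q by (blast intro: continuous_map_compose quotient_imp_continuous_map)
  moreover have "line \<circ> (*v) A = pact A \<circ> line"
    by (auto simp: pact_line)
  ultimately show ?thesis
    using continuous_compose_quotient_map[OF q] by metis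
qed

lemma homeomorphic_map_pact:
  assumes "A ** B = mat 1" "B ** A = mat 1"
  shows "homeomorphic_map proj_space proj_space (pact A)"
proof -
  have "homeomorphic_maps proj_space proj_space (pact A) (pact B)"
    using assms by (auto simp: homeomorphic_maps_def pact_pact intro: continuous_map_pact)
  then show ?thesis
    by (rule homeomorphic_maps_map[THEN iffD1, THEN conjunct1])
qed

lemma inj_pact:
  assumes "B ** A = mat 1"
  shows "inj (pact A)"
  by (rule inj_on_inverseI[of _ "pact B"]) (simp add: pact_pact assms)

lemma pact_image_eq:
  assumes "A ** B = mat 1" "pact A ` X \<subseteq> X" "pact B ` X \<subseteq> X"
  shows "pact A ` X = X"
proof
  show "X \<subseteq> pact A ` X"
  proof
    fix L assume "L \<in> X"
    then have "pact B L \<in> X"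
      using assms(3) by blast
    then show "L \<in> pact A ` X"
      by (rule rev_image_eqI) (simp add: pact_pact assms(1))
  qed
qed (use assms in simp)

section \<open>Isometries acting on the model and its chambers\<close>

lemma pact_Omega0_subset:
  assumes "\<And>x. q (A *v x) = q x"
  shows "pact A ` Omega0 \<subseteq> Omega0"
proof -
  have "pact A (line v) \<in> Omega0" if "q v < 0" for v
    using that unfolding pact_line Omega0_def by (intro imageI) (simp add: assms)
  then show ?thesis
    unfolding Omega0_def by blast
qed

lemma Omega0_subset: "Omega0 \<subseteq> topspace proj_space"
proof -
  have "{v :: 'a vect. q v < 0} \<subseteq> - {0}"
    by (auto simp: q_def)
  then show ?thesis
    unfolding Omega0_def proj_space_def topspace_quotient_topology by (auto intro: imageI)
qed

text \<open>A homeomorphism preserving \<open>Omega0\<close> and the union of the translates of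
  \<open>Hyp\<close> permutes the chambers; since it preserves \<open>Hyp\<close> and commutes with
  closure, bordering chambers stay bordering.\<close>

lemma pact_bordering:
  fixes \<Lambda> :: "'d::{finite,linorder} sqmat set"
  assumes inv: "A ** B = mat 1" "B ** A = mat 1"
    and q: "\<And>x. q (A *v x) = q x" "\<And>x. q (B *v x) = q x"
    and mem: "A \<in> \<Lambda>" "B \<in> \<Lambda>"
    and closed: "\<And>X Y. X \<in> \<Lambda> \<Longrightarrow> Y \<in> \<Lambda> \<Longrightarrow> X ** Y \<in> \<Lambda>"
    and Hyp: "pact A ` Hyp = Hyp"
    and C: "C \<in> bordering \<Lambda>"
  shows "pact A ` C \<in> bordering \<Lambda>"
proof -
  let ?U = "\<Union>\<gamma>\<in>\<Lambda>. pact \<gamma> ` Hyp"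
  let ?X = "subtopology proj_space (Omega0 - ?U)"
  note hom = homeomorphic_map_pact[OF inv]
  have "pact X ` ?U \<subseteq> ?U" if "X \<in> \<Lambda>" for X
  proof -
    have "pact X (pact \<gamma> L) \<in> ?U" if "\<gamma> \<in> \<Lambda>" "L \<in> Hyp" for \<gamma> L
      using closed[OF \<open>X \<in> \<Lambda>\<close> that(1)] that(2) unfolding pact_pact by blast
    then show ?thesis
      by blast
  qed
  then have U: "pact A ` ?U = ?U"
    using mem by (intro pact_image_eq[OF inv(1)]) simp_all
  have Om: "pact A ` Omega0 = Omega0"
    by (rule pact_image_eq[OF inv(1)]) (rule pact_Omega0_subset[OF q(1)] pact_Omega0_subset[OF q(2)])+
  have X: "pact A ` (Omega0 - ?U) = Omega0 - ?U"
    by (simp only: image_set_diff[OF inj_pact[OF inv(2)]] U Om)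
  have sub: "topspace proj_space \<inter> (Omega0 - ?U) = Omega0 - ?U"
    using Omega0_subset by auto
  have "homeomorphic_map ?X ?X (pact A)"
    by (rule homeomorphic_map_subtopologies[OF hom]) (simp only: sub X)
  note comps = homeomorphic_map_connected_components_of[OF this]
  have C': "C \<in> connected_components_of ?X" "Hyp \<subseteq> proj_space closure_of C"
    using C by (simp_all add: bordering_def chambers_def)
  have "pact A ` C \<in> connected_components_of ?X"
    using imageI[OF C'(1), of "(`) (pact A)"] by (simp only: comps[symmetric])
  moreover have "C \<subseteq> topspace proj_space"
    using connected_components_of_subset[OF C'(1)] by simp
  then have "proj_space closure_of (pact A ` C) = pact A ` (proj_space closure_of C)"
    by (rule homeomorphic_map_closure_of[OF hom])
  then have "Hyp \<subseteq> proj_space closure_of (pact A ` C)"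
    using image_mono[OF C'(2), of "pact A"] by (simp only: Hyp)
  ultimately show ?thesis
    by (simp add: bordering_def chambers_def)
qed

text \<open>The first coordinate is untouched. The distinctness conditions call for at least four
  coordinates, that is n >= 3.\<close>

lemma pact_transv_Hyp:
  fixes j k :: "'d::{finite,linorder}"
  assumes jk: "j \<noteq> k" "j \<noteq> ix_last" "k \<noteq> ix_last"
    and first: "j \<noteq> ix_first" "k \<noteq> ix_first" "(ix_last :: 'd) \<noteq> ix_first"
  shows "pact (transv j k ix_last s) ` Hyp = Hyp"
proof (rule pact_image_eq[where B = "transv j k ix_last (- s)"])
  have "(transv j k ix_last r *v x) $ ix_first = x $ ix_first" for r and x :: "'d vect"
    using first by (auto simp: transv_mult_vec transv_fun_def)
  then have "pact (transv j k ix_last r) ` Hyp \<subseteq> Hyp" for r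
    using pact_Omega0_subset[OF q_transv[OF jk], of r] unfolding Hyp_def
    by (fastforce simp: pact_def[of _ L for L])
  then show "pact (transv j k ix_last s) ` Hyp \<subseteq> Hyp" "pact (transv j k ix_last (- s)) ` Hyp \<subseteq> Hyp"
    by blast+
qed (simp add: transv_mult[OF jk] transv_0)


section \<open>Unipotent elements of the bent group\<close>

lemma ix_last_neq_first:
  assumes "CARD('d::{finite,linorder}) > 1"
  shows "(ix_last :: 'd) \<noteq> ix_first"
proof
  assume eq: "(ix_last :: 'd) = ix_first"
  have "x = ix_first" for x :: 'd
  proof (rule antisym)
    show "x \<le> ix_first"
      unfolding eq[symmetric] by (simp add: ix_last_def)
  qed (simp add: ix_first_def)
  then have "(UNIV :: 'd set) \<subseteq> {ix_first}"
    by blast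
  then have "CARD('d) \<le> card {ix_first :: 'd}"
    by (intro card_mono) simp_all
  then show False
    using assms by simp
qed

text \<open>Infinitely many indices share finitely many cosets. The condition \<open>one\<close>
  stands in for the group axioms of \<open>G\<close>, and both quotients \<open>g\<close>,
  \<open>h\<close> are returned so that no inverse has to be formed.\<close>

lemma rcoset_pigeonhole:
  fixes f :: "nat \<Rightarrow> 'a"
  assumes "subgroup H G" "finite (rcosets\<^bsub>G\<^esub> H)" "range f \<subseteq> carrier G"
    and one: "\<And>i. \<one>\<^bsub>G\<^esub> \<otimes>\<^bsub>G\<^esub> f i = f i"
  obtains i j g h where "i < j" "g \<in> H" "h \<in> H" "f j = g \<otimes>\<^bsub>G\<^esub> f i" "f i = h \<otimes>\<^bsub>G\<^esub> f j"
proof -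
  have "range (\<lambda>i. H #>\<^bsub>G\<^esub> f i) \<subseteq> rcosets\<^bsub>G\<^esub> H"
    using assms(3) by (auto simp: RCOSETS_def)
  then have "finite (range (\<lambda>i. H #>\<^bsub>G\<^esub> f i))"
    using assms(2) finite_subset by blast
  then have "\<not> inj (\<lambda>i. H #>\<^bsub>G\<^esub> f i)"
    using finite_imageD infinite_UNIV_nat by blast
  then obtain i j where ij: "i < j" "H #>\<^bsub>G\<^esub> f i = H #>\<^bsub>G\<^esub> f j"
    by (metis (mono_tags, lifting) injI linorder_neqE_nat)
  have "f i \<in> H #>\<^bsub>G\<^esub> f i" for i
    using one[of i] subgroup.one_closed[OF assms(1)] by (force simp: r_coset_def)
  then have "f j \<in> H #>\<^bsub>G\<^esub> f i" "f i \<in> H #>\<^bsub>G\<^esub> f j"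
    using ij(2) by blast+
  with ij(1) show thesis
    by (auto simp: r_coset_def intro: that)
qed

text \<open>Two transvections of distinct even parameters lie in one coset; their quotients are the
  transvections of parameter plus and minus the difference.\<close>

lemma transv_mem_finite_index:
  fixes \<Lambda> :: "'d::{finite,linorder} sqmat set"
  assumes jk: "j \<noteq> k" "j \<noteq> ix_last" "k \<noteq> ix_last"
    and sub: "subgroup \<Lambda> (SL_on (SLZ \<inter> SOq))"
    and fin: "finite (rcosets\<^bsub>SL_on (SLZ \<inter> SOq)\<^esub> \<Lambda>)"
  obtains s where "s > 0" "transv j k ix_last s \<in> \<Lambda>" "transv j k ix_last (- s) \<in> \<Lambda>"
proof -
  let ?T = "transv j k (ix_last :: 'd)"
  have mem: "?T (2 * real i) \<in> SLZ \<inter> SOq" for i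
    using transv_in_SLZ[OF jk, of "int i"] det_transv[OF jk] q_transv[OF jk] by (simp add: SOq_def)
  obtain i l g h where il: "i < l" and gh: "g \<in> \<Lambda>" "h \<in> \<Lambda>"
    "?T (2 * real l) = g ** ?T (2 * real i)" "?T (2 * real i) = h ** ?T (2 * real l)"
    by (rule rcoset_pigeonhole[OF sub fin, of "\<lambda>i. ?T (2 * real i)"])
      (use mem in \<open>auto simp: SL_def\<close>)
  have "X = ?T (r - s)" if "?T r = X ** ?T s" for X r s
  proof -
    have "?T (r - s) = X ** ?T s ** ?T (- s)"
      unfolding that[symmetric] transv_mult[OF jk] by simp
    then show ?thesis
      by (simp add: matrix_mul_assoc[symmetric] transv_mult[OF jk] transv_0)
  qed
  from this[OF gh(3)] this[OF gh(4)] gh(1,2) show thesis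
    using il by (intro that[of "2 * real l - 2 * real i"]) simp_all
qed

text \<open>An injection of a pair into itself fixes or swaps the points. It serves for the action
  on the bordering chambers.\<close>

lemma image_involution_pair:
  assumes "inj f" "f ` {a, b} \<subseteq> {a, b}"
  shows "f (f a) = a"
proof (cases "f a = a")
  case False
  then have "f a = b" "f b = a \<or> f b = b"
    using assms(2) by simp_all
  moreover have "f b \<noteq> f a"
    using False \<open>f a = b\<close> injD[OF assms(1), of b a] by metis
  ultimately show ?thesis
    by simp
qed simp

lemma not_Schottky_ge_3:
  fixes \<Lambda> :: "'d::{finite,linorder} sqmat set"
  assumes card: "CARD('d) > 3"
    and adm: "admissible \<Lambda>"
    and bend: "bending \<Lambda> t \<rho>"
  shows "\<not> Schottky (\<rho> ` \<Lambda>)"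
proof -
  have sub: "subgroup \<Lambda> (SL_on (SLZ \<inter> SOq))"
    and fin: "finite (rcosets\<^bsub>SL_on (SLZ \<inter> SOq)\<^esub> \<Lambda>)"
    using adm by (auto simp: admissible_def)
  have closed: "X ** Y \<in> \<Lambda>" if "X \<in> \<Lambda>" "Y \<in> \<Lambda>" for X Y
    using subgroup.m_closed[OF sub that] by (simp add: SL_def)
  have "card {ix_first, ix_last :: 'd} \<le> 2"
    by (simp add: card_insert_if)
  then have "2 \<le> card (UNIV - {ix_first, ix_last :: 'd})"
    using card by (simp add: card_Diff_subset)
  then obtain S where S: "S \<subseteq> UNIV - {ix_first, ix_last :: 'd}" "card S = 2"
    by (rule obtain_subset_with_card_n)
  then obtain j k :: 'd where "S = {j, k}" and "j \<noteq> k"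
    by (auto simp: card_2_iff)
  with S(1) have jk: "j \<noteq> k" "j \<noteq> ix_last" "k \<noteq> ix_last"
    and first: "j \<noteq> ix_first" "k \<noteq> ix_first"
    by simp_all
  have last: "(ix_last :: 'd) \<noteq> ix_first"
    using card by (intro ix_last_neq_first) simp
  let ?T = "transv j k (ix_last :: 'd)"
  obtain s where s: "s > 0" "?T s \<in> \<Lambda>" "?T (- s) \<in> \<Lambda>"
    by (rule transv_mem_finite_index[OF jk sub fin])
  note mult = transv_mult[OF jk] and Hyp = pact_transv_Hyp[OF jk first last]
  have T2: "?T (2 * s) = ?T s ** ?T s"
    by (simp add: mult)
  have bord: "pact (?T s) ` C \<in> bordering \<Lambda>" if "C \<in> bordering \<Lambda>" for C
    by (rule pact_bordering[where B = "?T (- s)"])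
      (use s closed Hyp that q_transv[OF jk] in \<open>simp_all add: mult transv_0\<close>)
  have inj: "inj ((`) (pact (?T s)))"
    by (rule injI, rule inj_image_eq_iff[THEN iffD1, OF inj_pact[where B = "?T (- s)"]])
      (simp_all only: mult transv_0 left_minus)
  have "?T (2 * s) \<in> Stab \<Lambda> C" if "bordering \<Lambda> = {C, C'}" for C C'
  proof -
    have "pact (?T s) ` C \<in> {C, C'}" "pact (?T s) ` C' \<in> {C, C'}"
      using bord[of C] bord[of C'] unfolding that by simp_all
    then have "(`) (pact (?T s)) ` {C, C'} \<subseteq> {C, C'}"
      by (simp only: image_insert image_empty insert_subset empty_subsetI simp_thms)
    then have "pact (?T s) ` pact (?T s) ` C = C"
      by (rule image_involution_pair[OF inj])
    then have "pact (?T (2 * s)) ` C = C"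
      by (simp only: T2 image_image pact_pact)
    then show ?thesis
      using closed[OF s(2,2)] by (simp add: Stab_def T2)
  qed
  \<comment> \<open>Either kind of bending is the identity on the stabilizer of one bordering
    chamber: \<open>Cg\<close> or \<open>C\<close>.\<close>
  moreover have "\<exists>C C'. bordering \<Lambda> = {C, C'} \<and> (\<forall>\<gamma>\<in>Stab \<Lambda> C. \<rho> \<gamma> = \<gamma>)"
    using bend unfolding bending_def separating_bending_def nonseparating_bending_def
    by (elim disjE conjE exE bexE) (intro exI conjI, assumption+)+
  ultimately have fixed: "\<rho> (?T (2 * s)) = ?T (2 * s)"
    by blast
  have "?T (2 * s) \<in> \<Lambda>"
    unfolding T2 by (rule closed[OF s(2,2)])
  then have "\<rho> (?T (2 * s)) \<in> \<rho> ` \<Lambda>"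
    by (rule imageI)
  then have mem: "?T (2 * s) \<in> \<rho> ` \<Lambda>"
    by (simp only: fixed)
  \<comment> \<open>\<open>Schottky\<close> exempts the identity, so nontriviality must be checked;
    this entry is \<open>2 * s\<close>.\<close>
  have "?T (2 * s) $ k $ j \<noteq> (mat 1 :: 'd sqmat) $ k $ j"
    using jk s(1) by (simp add: transv_entry mat_def)
  then have "?T (2 * s) \<noteq> mat 1"
    by metis
  then show ?thesis
    using transv_not_loxodromic[OF jk] mem unfolding Schottky_def by blast
qed


section \<open>Dimension two\<close>

text \<open>The next square after \<open>c\<^sup>2\<close> exceeds it by
  \<open>2 * \<bar>c\<bar> + 1\<close>, which is more than 1 unless \<open>c = 0\<close>.\<close>

lemma int_square_eq_square_plus_1:
  fixes a c :: int
  assumes "a\<^sup>2 = c\<^sup>2 + 1"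
  shows "c = 0"
proof (rule ccontr)
  assume "c \<noteq> 0"
  have "\<bar>c\<bar>\<^sup>2 < \<bar>a\<bar>\<^sup>2"
    using assms by simp
  then have "\<bar>c\<bar> < \<bar>a\<bar>"
    by (rule power_less_imp_less_base) simp
  then have "(\<bar>c\<bar> + 1)\<^sup>2 \<le> \<bar>a\<bar>\<^sup>2"
    by (intro power_mono) auto
  then have "c\<^sup>2 + 2 * \<bar>c\<bar> + 1 \<le> a\<^sup>2"
    by (simp add: power2_eq_square algebra_simps abs_mult_self_eq)
  then show False
    using assms \<open>c \<noteq> 0\<close> by simp
qed

lemma Ints_square_eq_square_plus_1:
  fixes a c :: real
  assumes "a \<in> \<int>" "c \<in> \<int>" "a\<^sup>2 = c\<^sup>2 + 1"
  shows "c = 0" "a\<^sup>2 = 1"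
proof -
  obtain i j where ij: "a = of_int i" "c = of_int j"
    using assms(1,2) by (auto elim!: Ints_cases)
  have "real_of_int (i\<^sup>2) = of_int (j\<^sup>2 + 1)"
    using assms(3) by (simp add: ij)
  then have "i\<^sup>2 = j\<^sup>2 + 1"
    by (simp only: of_int_eq_iff)
  then show "c = 0"
    using int_square_eq_square_plus_1 ij(2) by simp
  then show "a\<^sup>2 = 1"
    using assms(3) by simp
qed

section \<open>The stabilizer of the hyperplane for n = 2\<close>

lemma obtain_third_index:
  assumes "CARD('d::{finite,linorder}) = 3"
  obtains k :: "'d::{finite,linorder}" where "k \<noteq> ix_first" "k \<noteq> ix_last" "UNIV = {ix_first, k, ix_last}"
proof -
  have "(ix_last :: 'd) \<noteq> ix_first"
    using assms by (intro ix_last_neq_first) simp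
  then have 2: "card {ix_first, ix_last :: 'd} = 2"
    by simp
  then have "card (UNIV - {ix_first, ix_last :: 'd}) = 1"
    using assms by (simp add: card_Diff_subset)
  then obtain k where "UNIV - {ix_first, ix_last :: 'd} = {k}"
    by (auto simp: card_1_singleton_iff)
  then show thesis
    by (intro that[of k]) auto
qed

lemma line_in_Hyp:
  assumes "q v < 0" "v $ ix_first = 0"
  shows "line v \<in> Hyp"
  using assms unfolding Hyp_def Omega0_def line_def span_singleton by auto

text \<open>In dimension two the stabilizer of \<open>Hyp\<close> in \<open>SO(q,\<int>)\<close> consists of diagonal matrices with
  entries \<open>\<plusminus>1\<close>, because \<open>x\<^sup>2 - y\<^sup>2\<close> takes the values \<open>\<plusminus>1\<close> on \<open>\<int>\<^sup>2\<close> only on the axes.\<close>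

lemma Stab_Hyp_involution:
  fixes \<gamma> :: "'d::{finite,linorder} sqmat"
  assumes card: "CARD('d) = 3" and \<gamma>: "\<gamma> \<in> SLZ" "\<gamma> \<in> SOq" and Hyp: "pact \<gamma> ` Hyp = Hyp"
  shows "\<gamma> ** \<gamma> = mat 1"
proof -
  obtain k :: 'd where k: "k \<noteq> ix_first" "k \<noteq> ix_last" and U: "UNIV = {ix_first, k, ix_last}"
    by (rule obtain_third_index[OF card])
  have last: "(ix_last :: 'd) \<noteq> ix_first"
    using card by (intro ix_last_neq_first) simp
  let ?f = "ix_first :: 'd" and ?l = "ix_last :: 'd"
  have q: "q x = (x $ ?f)\<^sup>2 + (x $ k)\<^sup>2 - (x $ ?l)\<^sup>2" for x
  proof -
    have "UNIV - {?l} = {?f, k}"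
      using U k last by auto
    then show ?thesis
      using k by (simp add: q_def)
  qed
  define g where "g i j = \<gamma> $ i $ j" for i j
  define v where "v a b c = (\<chi> i. if i = ?f then a else if i = k then b else (c :: real))" for a b c
  have v: "v a b c $ ?f = a" "v a b c $ k = b" "v a b c $ ?l = c" for a b c
    using k last by (auto simp: v_def)
  have mv: "(\<gamma> *v v a b c) $ i = g i ?f * a + g i k * b + g i ?l * c" for i a b c
    unfolding matrix_vector_mult_def U using k last by (simp add: v g_def)
  have inv: "q (\<gamma> *v x) = q x" for x
    using \<gamma>(2) by (simp add: SOq_def)
  have eq: "(g ?f ?f * a + g ?f k * b + g ?f ?l * c)\<^sup>2 + (g k ?f * a + g k k * b + g k ?l * c)\<^sup>2
      - (g ?l ?f * a + g ?l k * b + g ?l ?l * c)\<^sup>2 = a\<^sup>2 + b\<^sup>2 - c\<^sup>2" for a b c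
    using inv[of "v a b c"] by (simp add: q v mv)
  have int: "g i j \<in> \<int>" for i j
    using \<gamma>(1) by (simp add: SLZ_def g_def)
  \<comment> \<open>Negative vectors (0, b, c) represent points of \<open>Hyp\<close>, so their
    images have first coordinate 0.\<close>
  have first: "g ?f k * b + g ?f ?l * c = 0" if "b\<^sup>2 - c\<^sup>2 < 0" for b c
  proof -
    have "line (v 0 b c) \<in> Hyp"
      using that by (intro line_in_Hyp) (simp_all add: q v)
    then have "line (\<gamma> *v v 0 b c) \<in> Hyp"
      using imageI[of "line (v 0 b c)" Hyp "pact \<gamma>"] unfolding Hyp pact_line by simp
    moreover have "\<gamma> *v v 0 b c \<in> line (\<gamma> *v v 0 b c)"
      by (simp add: line_def span_base)
    ultimately have "(\<gamma> *v v 0 b c) $ ?f = 0"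
      unfolding Hyp_def by blast
    then show ?thesis
      by (simp add: mv)
  qed
  have fl: "g ?f ?l = 0"
    using first[of 0 1] by simp
  have fk: "g ?f k = 0"
    using first[of 1 2] fl by simp
  \<comment> \<open>The isometry identity at the last and the \<open>k\<close>-th basis vectors
    meets the integer lemma: the mixed entries vanish and the diagonal ones square to 1.\<close>
  have "(g ?l ?l)\<^sup>2 = (g k ?l)\<^sup>2 + 1"
    using eq[of 0 0 1] by (simp add: fl)
  note l = Ints_square_eq_square_plus_1[OF int int this]
  have "(g k k)\<^sup>2 = (g ?l k)\<^sup>2 + 1"
    using eq[of 0 1 0] by (simp add: fk)
  note k' = Ints_square_eq_square_plus_1[OF int int this]
  \<comment> \<open>Polarization: comparing the values at (1, 0, 0) and (1, 0, 1) isolates the cross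
    term.\<close>
  have "g ?l ?f * g ?l ?l = 0"
    using eq[of 1 0 0] eq[of 1 0 1] l by (simp add: fl power2_sum del: mult_eq_0_iff)
  then have lf: "g ?l ?f = 0"
    using l(2) by auto
  have "(g ?f ?f)\<^sup>2 + (g k ?f)\<^sup>2 = 1" "(g ?f ?f)\<^sup>2 + (g k ?f + g k k)\<^sup>2 = 2"
    using eq[of 1 0 0] eq[of 1 1 0] k' by (simp_all add: fk lf)
  then have "g k ?f * g k k = 0"
    using k'(2) unfolding power2_sum by linarith
  then have kf: "g k ?f = 0"
    using k'(2) by auto
  have ff: "(g ?f ?f)\<^sup>2 = 1"
    using eq[of 1 0 0] by (simp add: kf lf)
  have prod: "(\<gamma> ** \<gamma>) $ i $ j = g i ?f * g ?f j + g i k * g k j + g i ?l * g ?l j" for i j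
    unfolding matrix_matrix_mult_def U using k last by (simp add: g_def)
  have idx: "i = ?f \<or> i = k \<or> i = ?l" for i
    using U by blast
  have "(\<gamma> ** \<gamma>) $ i $ j = (if i = j then 1 else 0)" for i j
    using idx[of i] idx[of j] by (elim disjE)
      (use k last lf kf fl fk l(1) k'(1) ff l(2) k'(2) in \<open>simp_all add: prod power2_eq_square\<close>)
  then show ?thesis
    by (simp add: vec_eq_iff mat_def)
qed

text \<open>Every such element squares to the identity, and \<open>\<Lambda>\<close> is
  torsion-free.\<close>

lemma Stab_Hyp_trivial:
  fixes \<Lambda> :: "'d::{finite,linorder} sqmat set"
  assumes "CARD('d) = 3" and "\<Lambda> \<subseteq> SLZ \<inter> SOq" and "torsion_free (SL_on \<Lambda>)" and "\<gamma> \<in> Stab \<Lambda> Hyp"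
  shows "\<gamma> = mat 1"
proof -
  have "\<gamma> \<in> \<Lambda>" "pact \<gamma> ` Hyp = Hyp"
    using assms(4) by (simp_all add: Stab_def)
  then have "\<gamma> ** \<gamma> = mat 1"
    using assms(2) by (intro Stab_Hyp_involution[OF assms(1)]) auto
  then have "\<gamma> [^]\<^bsub>SL_on \<Lambda>\<^esub> (2::nat) = \<one>\<^bsub>SL_on \<Lambda>\<^esub>"
    by (simp add: numeral_2_eq_2 nat_pow_def SL_def)
  then have "\<gamma> = \<one>\<^bsub>SL_on \<Lambda>\<^esub>"
    using assms(3)[unfolded torsion_free_def, rule_format, of \<gamma> 2] \<open>\<gamma> \<in> \<Lambda>\<close> by simp
  then show ?thesis
    by (simp add: SL_def)
qed

section \<open>Infinite length of the geodesic x_1 = 0\<close>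

text \<open>In the plane \<open>x\<^sub>1 = 0\<close>, with coordinates \<open>y, z\<close>, the region \<open>-1 < y\<^sup>2 - z\<^sup>2 < 0\<close> contains the
  disjoint squares \<open>(\<surd>m, c) \<times> (c, \<surd>(m+1))\<close>, where \<open>c\<close> is the midpoint of \<open>\<surd>m\<close> and \<open>\<surd>(m+1)\<close>;
  their areas are comparable to \<open>1/m\<close>.\<close>

lemma sqrt_gap_square: "((sqrt (real m + 1) - sqrt (real m)) / 2)\<^sup>2 \<ge> inverse (real (Suc m)) / 16"
proof -
  let ?a = "sqrt (real m)" and ?b = "sqrt (real m + 1)"
  have "?a \<le> ?b" "0 < ?b" "0 \<le> ?a"
    by simp_all
  \<comment> \<open>The gap is the reciprocal of \<open>?b + ?a\<close>, which is at most
    \<open>2 * ?b\<close>.\<close>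
  moreover have "(?b - ?a) * (?b + ?a) = 1"
    by (simp add: algebra_simps flip: power2_eq_square)
  ultimately have "1 \<le> (?b - ?a) * (2 * ?b)"
    using mult_left_mono[of "?b + ?a" "2 * ?b" "?b - ?a"] by simp
  then have "inverse (4 * ?b) \<le> (?b - ?a) / 2"
    using \<open>0 < ?b\<close> by (simp add: field_simps)
  then have "(inverse (4 * ?b))\<^sup>2 \<le> ((?b - ?a) / 2)\<^sup>2"
    using \<open>0 < ?b\<close> by (intro power_mono) simp_all
  then show ?thesis
    by (simp add: power_inverse power_mult_distrib field_simps)
qed

text \<open>Disjoint boxes of thickness 1 over the squares fit inside, so a finite measure would
  bound the partial sums of a multiple of the harmonic series.\<close>

lemma emeasure_cone_Hyp:
  assumes card: "CARD('d::{finite,linorder}) = 3"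
    and meas: "cone_Hyp (Hyp :: 'd::{finite,linorder} vect set set) \<in> sets borel"
  shows "emeasure lborel (cone_Hyp (Hyp :: 'd::{finite,linorder} vect set set)) = \<infinity>"
proof (rule ccontr)
  let ?K = "cone_Hyp (Hyp :: 'd vect set set)"
  assume "emeasure lborel ?K \<noteq> \<infinity>"
  then have fm: "?K \<in> fmeasurable lborel"
    using meas by (intro fmeasurableI) (simp_all add: top.not_eq_extremum)
  obtain k :: 'd where k: "k \<noteq> ix_first" "k \<noteq> ix_last" and U: "UNIV = {ix_first, k, ix_last}"
    by (rule obtain_third_index[OF card])
  have last: "(ix_last :: 'd) \<noteq> ix_first"
    using card by (intro ix_last_neq_first) simp
  let ?f = "ix_first :: 'd" and ?l = "ix_last :: 'd"
  define c where "c m = (sqrt (real m) + sqrt (real m + 1)) / 2" for m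
  define lo where "lo m = (\<chi> i. if i = ?f then 0 else if i = k then sqrt (real m) else c m)" for m
  define hi where "hi m = (\<chi> i. if i = ?f then 1 else if i = k then c m else sqrt (real m + 1))" for m
  have all: "(\<forall>i. P i) \<longleftrightarrow> P ?f \<and> P k \<and> P ?l" for P
  proof -
    have "(\<forall>i\<in>UNIV. P i) \<longleftrightarrow> P ?f \<and> P k \<and> P ?l"
      unfolding U by simp
    then show ?thesis
      by simp
  qed
  have box: "x \<in> box (lo m) (hi m) \<longleftrightarrow> 0 < x $ ?f \<and> x $ ?f < 1 \<and>
      sqrt (real m) < x $ k \<and> x $ k < c m \<and> c m < x $ ?l \<and> x $ ?l < sqrt (real m + 1)" for x m
    using k last by (auto simp: mem_box_cart all lo_def hi_def)
  have sub: "box (lo m) (hi m) \<subseteq> ?K" for m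
  proof
    fix x assume "x \<in> box (lo m) (hi m)"
    note x = this[unfolded box]
    define v where "v = x - axis ?f (x $ ?f)"
    have v: "v $ ?f = 0" "v $ k = x $ k" "v $ ?l = x $ ?l"
      using k last by (simp_all add: v_def axis_def)
    have "UNIV - {?l} = {?f, k}"
      using U k last by auto
    then have q: "q v = (x $ k)\<^sup>2 - (x $ ?l)\<^sup>2"
      using k by (simp add: q_def v)
    have "0 \<le> sqrt (real m)"
      by simp
    with x have pos: "0 \<le> x $ k" "x $ k < x $ ?l"
      by linarith+
    \<comment> \<open>Thus m < y^2 < z^2 < m + 1, which puts \<open>q v\<close> between -1 and
      0.\<close>
    have "(sqrt (real m))\<^sup>2 < (x $ k)\<^sup>2" "(x $ ?l)\<^sup>2 < (sqrt (real m + 1))\<^sup>2" "(x $ k)\<^sup>2 < (x $ ?l)\<^sup>2"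
      using x pos by (simp_all only: power_strict_mono real_sqrt_ge_zero of_nat_0_le_iff
          order.trans[OF pos(1) less_imp_le[OF pos(2)]] zero_less_numeral)
    then have "-1 < q v" "q v < 0"
      by (simp_all add: q)
    then show "x \<in> ?K"
      using x line_in_Hyp[of v] v(1) by (simp add: cone_Hyp_def cone_Omega_def v_def)
  qed
  have mu: "measure lborel (box (lo m) (hi m)) = ((sqrt (real m + 1) - sqrt (real m)) / 2)\<^sup>2" for m
  proof -
    have "sqrt (real m) \<le> c m" "c m \<le> sqrt (real m + 1)"
      by (simp_all add: c_def)
    then have "cbox (lo m) (hi m) \<noteq> {}"
      using k last by (auto simp: interval_ne_empty_cart all lo_def hi_def)
    then have "measure lborel (cbox (lo m) (hi m)) = (\<Prod>i\<in>UNIV. hi m $ i - lo m $ i)"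
      by (rule content_cbox_cart)
    also have "\<dots> = (c m - sqrt (real m)) * (sqrt (real m + 1) - c m)"
      unfolding U using k last by (simp add: lo_def hi_def)
    also have "\<dots> = ((sqrt (real m + 1) - sqrt (real m)) / 2)\<^sup>2"
      by (simp add: c_def power2_eq_square field_simps)
    finally show ?thesis
      by (simp add: measure_lborel_box_eq measure_lborel_cbox_eq)
  qed
  \<comment> \<open>The boxes are ordered along coordinate \<open>k\<close>, since
    \<open>c i < sqrt (real i + 1)\<close> whenever box \<open>i\<close> has a point.\<close>
  have less: "x $ k < y $ k"
    if "x \<in> box (lo i) (hi i)" "y \<in> box (lo j) (hi j)" "i < j" for x y i j
  proof -
    have "sqrt (real i + 1) \<le> sqrt (real j)"
      using \<open>i < j\<close> by simp
    with that(1,2) show ?thesis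
      unfolding box by linarith
  qed
  have disj: "disjoint_family (\<lambda>m. box (lo m) (hi m))"
    unfolding disjoint_family_on_def
  proof (intro ballI impI)
    fix i j :: nat assume "i \<noteq> j"
    then show "box (lo i) (hi i) \<inter> box (lo j) (hi j) = {}"
      using less[of _ i _ j] less[of _ j _ i] by (cases "i < j") fastforce+
  qed
  have "(\<Sum>m<N. inverse (real (Suc m)) / 16) \<le> measure lborel ?K" for N
  proof -
    have "(\<Sum>m<N. inverse (real (Suc m)) / 16) \<le> (\<Sum>m<N. measure lborel (box (lo m) (hi m)))"
      unfolding mu by (intro sum_mono sqrt_gap_square)
    also have "\<dots> = measure lborel (\<Union>m<N. box (lo m) (hi m))"
      by (rule measure_finite_Union[symmetric])
        (use disj in \<open>auto simp: disjoint_family_on_def emeasure_lborel_box_eq\<close>)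
    also have "\<dots> \<le> measure lborel ?K"
      using sub fm by (intro measure_mono_fmeasurable) auto
    finally show ?thesis .
  qed
  then have "summable (\<lambda>m. inverse (real (Suc m)) / 16)"
    by (rule summableI_nonneg_bounded[rotated]) simp
  then have "summable (\<lambda>m. inverse (real (Suc m)))"
    using summable_mult[of "\<lambda>m. inverse (real (Suc m)) / 16" 16] by simp
  then show False
    using not_summable_harmonic[where 'a = real] summable_Suc_iff[of "\<lambda>m. inverse (real m)"] by simp
qed

lemma not_admissible_dim_2:
  fixes \<Lambda> :: "'d::{finite,linorder} sqmat set"
  assumes card: "CARD('d) = 3"
  shows "\<not> admissible \<Lambda>"
proof
  assume "admissible \<Lambda>"
  then have adm: "subgroup \<Lambda> (SL_on (SLZ \<inter> SOq))" "torsion_free (SL_on \<Lambda>)"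
    "finite_volume_quotient cone_Hyp (Stab \<Lambda> Hyp) Hyp"
    by (simp_all only: admissible_def)
  have "\<Lambda> \<subseteq> SLZ \<inter> SOq"
    using subgroup.subset[OF adm(1)] by simp
  note triv = Stab_Hyp_trivial[OF card this adm(2)]
  obtain D where D: "D \<subseteq> Hyp" "\<And>L. L \<in> Hyp \<Longrightarrow> \<exists>L'. L' \<in> D \<and> L' \<in> orbit_of (Stab \<Lambda> Hyp) L"
    "cone_Hyp D \<in> sets borel" "emeasure lborel (cone_Hyp D) < \<infinity>"
  proof -
    obtain D where "D \<subseteq> Hyp" "\<forall>L\<in>Hyp. \<exists>!L'. L' \<in> D \<and> L' \<in> orbit_of (Stab \<Lambda> Hyp) L"
      "cone_Hyp D \<in> sets borel" "emeasure lborel (cone_Hyp D) < \<infinity>"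
      using adm(3) unfolding finite_volume_quotient_def by (elim exE conjE)
    then show thesis
      by (intro that[of D]) (simp_all add: ex1_implies_ex)
  qed
  \<comment> \<open>Orbits of the trivial stabilizer are single points, so the set of
    representatives is all of \<open>Hyp\<close>.\<close>
  have "L \<in> D" if L: "L \<in> Hyp" for L
  proof -
    obtain \<gamma> where "pact \<gamma> L \<in> D" "\<gamma> \<in> Stab \<Lambda> Hyp"
      using D(2)[OF L] by (auto simp: orbit_of_def)
    then show ?thesis
      using triv[of \<gamma>] by (simp only: pact_mat_1)
  qed
  then have "D = Hyp"
    using D(1) by blast
  then show False
    using emeasure_cone_Hyp[OF card] D(3,4) by simp
qed

theorem mainTheorem3:
  fixes \<Lambda>\<^sub>0 :: "'d::{finite,linorder} sqmat set"
    and \<rho> :: "'d sqmat \<Rightarrow> 'd sqmat"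
    and n :: nat and t :: real
  assumes "CARD('d) = n + 1" and "n \<ge> 2" and "t > 0"
    and "admissible \<Lambda>\<^sub>0"
    and "bending \<Lambda>\<^sub>0 t \<rho>"
  shows "\<not> Schottky (\<rho> ` \<Lambda>\<^sub>0)"
proof (cases "n = 2")
  case True
  with assms(1) have "CARD('d) = 3"
    by simp
  with assms(4) show ?thesis
    using not_admissible_dim_2 by blast
next
  case False
  with assms(1,2) have "CARD('d) > 3"
    by simp
  then show ?thesis
    by (rule not_Schottky_ge_3[OF _ assms(4,5)])
qed

end
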